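(* Let $E$ be a finite graph and $K$ a field. Let $$E=E_0\rightarrow E_1\rightarrow\cdots\rightarrow E_i\rightarrow\cdots\rightarrow E_t=E_{sf}$$ be a sequence of graphs which arises in some step-by-step process of source eliminations. If $E_i$ contains an isolated vertex for some $0\le i\le t$, or $E_{sf}$ contains a source cycle, then $L_K(E)$ has Invariant Basis Number.
   Context: A (directed) graph $E=(E^0,E^1,s,r)$ consists of two disjoint sets $E^0$ (vertices) and $E^1$ (edges) and maps $s,r:E^1\to E^0$ (source and range). It is finite if $E^0$ and $E^1$ are finite; $E^0$ is assumed nonempty. A vertex $v$ is a sink if $s^{-1}(v)=\emptyset$, a source if $r^{-1}(v)=\emptyset$, isolated if it is both a source and a sink, and regular if $0<|s^{-1}(v)|<\infty$. A graph is source-free if it has no sources. A path is a sequence of edges $p=e_1\cdots e_n$ ($n\ge 1$) with $r(e_i)=s(e_{i+1})$; $s(p)=s(e_1)$, $r(p)=r(e_n)$, and $p^0$ is its set of vertices. A cycle is a path $p$ with $s(p)=r(p)$ that does not revisit any other vertex (i.e. $s(e_1),\dots,s(e_n)$ are distinct). A cycle $c$ is a source cycle if $|r^{-1}(v)|=1$ for all $v\in c^0$. Source elimination: if $v$ is a source of $E$, $E_{\setminus v}$ is the graph with vertices $E^0\setminus\{v\}$, edges $E^1\setminus s^{-1}(v)$, and source and range maps restricted from $E$. A step-by-step process of source eliminations starting at the finite graph $E$ is a sequence $E=E_0\to E_1\to\cdots\to E_t$ in which each $E_{i+1}$ is $(E_i)_{\setminus v}$ for some source $v$ of $E_i$, continued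 until a source-free graph $E_t=:E_{sf}$ is reached; with the convention, to avoid the empty graph, that if $E_{t-1}$ is the graph $E_{triv}$ consisting of one vertex and no edges, then $E_t=E_{sf}:=E_{triv}$. (The resulting $E_{sf}$ does not depend on the order of eliminations.) For a field $K$, the Leavitt path algebra $L_K(E)$ is the $K$-algebra generated by $\{v,e,e^*\mid v\in E^0,e\in E^1\}$ subject to, for all $v,w\in E^0$, $e,f\in E^1$: (1) $vw=\delta_{v,w}w$; (2) $s(e)e=e=e\,r(e)$ and $r(e)e^*=e^*=e^*s(e)$; (3) $e^*f=\delta_{e,f}r(e)$; (4) $v=\sum_{e\in s^{-1}(v)}ee^*$ for every regular vertex $v$. For finite $E$ it is unital with identity $\sum_{v\in E^0}v$. A unital ring $R$ has Invariant Basis Number if for all positive integers $m,n$, $R^m\cong R^n$ as right $R$-modules implies $m=n$. *)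

theory Defs
  imports
    "Graph_Theory.Arc_Walk"
    "HOL-Algebra.QuotRing"
    "HOL-Library.Poly_Mapping"
begin

section \<open>Graphs and source elimination\<close>

definition is_sink :: "('v, 'e) pre_digraph \<Rightarrow> 'v \<Rightarrow> bool" where
  "is_sink G v \<longleftrightarrow> v \<in> verts G \<and> out_arcs G v = {}"

definition is_source :: "('v, 'e) pre_digraph \<Rightarrow> 'v \<Rightarrow> bool" where
  "is_source G v \<longleftrightarrow> v \<in> verts G \<and> in_arcs G v = {}"

definition is_isolated :: "('v, 'e) pre_digraph \<Rightarrow> 'v \<Rightarrow> bool" where
  "is_isolated G v \<longleftrightarrow> is_source G v \<and> is_sink G v"

definition is_regular :: "('v, 'e) pre_digraph \<Rightarrow> 'v \<Rightarrow> bool" where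
  "is_regular G v \<longleftrightarrow> v \<in> verts G \<and> out_arcs G v \<noteq> {} \<and> finite (out_arcs G v)"

definition source_free :: "('v, 'e) pre_digraph \<Rightarrow> bool" where
  "source_free G \<longleftrightarrow> (\<nexists>v. is_source G v)"

definition path_verts :: "('v, 'e) pre_digraph \<Rightarrow> 'e list \<Rightarrow> 'v set" where
  "path_verts G p = tail G ` set p \<union> head G ` set p"

definition source_cycle :: "('v, 'e) pre_digraph \<Rightarrow> 'e list \<Rightarrow> bool" where
  "source_cycle G c \<longleftrightarrow> pre_digraph.cycle G c \<and> (\<forall>v \<in> path_verts G c. in_degree G v = 1)"

definition eliminate_source :: "('v, 'e) pre_digraph \<Rightarrow> 'v \<Rightarrow> ('v, 'e) pre_digraph" where
  "eliminate_source G v = G\<lparr>verts := verts G - {v}, arcs := arcs G - out_arcs G v\<rparr>"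

definition trivial_graph :: "('v, 'e) pre_digraph \<Rightarrow> bool" where
  "trivial_graph G \<longleftrightarrow> card (verts G) = 1 \<and> arcs G = {}"

text \<open>
  The one-vertex graph without edges has a source, so it is not source-free; by convention a process
  that reaches it ends with one extra step that repeats it, instead of a step to the empty graph.
  Only the values \<open>Es 0, \<dots>, Es t\<close> matter.
\<close>
definition source_elimination_process ::
    "('v, 'e) pre_digraph \<Rightarrow> (nat \<Rightarrow> ('v, 'e) pre_digraph) \<Rightarrow> nat \<Rightarrow> bool" where
  "source_elimination_process G Es t \<longleftrightarrow>
     Es 0 = G \<and>
     (\<forall>i<t. (\<not> trivial_graph (Es i) \<and> (\<exists>v. is_source (Es i) v \<and> Es (Suc i) = eliminate_source (Es i) v)) \<or>
            (trivial_graph (Es i) \<and> Suc i = t \<and> Es (Suc i) = Es i)) \<and>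
     (source_free (Es t) \<or> (t > 0 \<and> trivial_graph (Es (t - 1))))"

section \<open>Leavitt path algebras\<close>

datatype ('v, 'e) gen = Vertex 'v | Edge 'e | Ghost 'e

definition gens :: "('v, 'e) pre_digraph \<Rightarrow> ('v, 'e) gen set" where
  "gens G = Vertex ` verts G \<union> Edge ` arcs G \<union> Ghost ` arcs G"

text \<open>
  Words form a monoid, written additively because the multiplication of \<^type>\<open>poly_mapping\<close> is the
  convolution over an additive monoid of exponents. Thus \<open>'a word \<Rightarrow>\<^sub>0 'k\<close> is the unital
  free associative \<open>'k\<close>-algebra on the letters \<open>'a\<close>.
\<close>
datatype 'a word = Word (letters: "'a list")

instantiation word :: (type) monoid_add
begin

definition zero_word :: "'a word" where
  "zero_word = Word []"

definition plus_word :: "'a word \<Rightarrow> 'a word \<Rightarrow> 'a word" where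
  "plus_word u w = Word (letters u @ letters w)"

instance
  by standard (simp_all add: zero_word_def plus_word_def)

end

type_synonym ('v, 'e, 'k) free_alg = "('v, 'e) gen word \<Rightarrow>\<^sub>0 'k"

definition letter :: "('v, 'e) gen \<Rightarrow> ('v, 'e, 'k::field) free_alg" where
  "letter g = Poly_Mapping.single (Word [g]) 1"

abbreviation vx :: "'v \<Rightarrow> ('v, 'e, 'k::field) free_alg" where
  "vx v \<equiv> letter (Vertex v)"

abbreviation ed :: "'e \<Rightarrow> ('v, 'e, 'k::field) free_alg" where
  "ed e \<equiv> letter (Edge e)"

abbreviation gh :: "'e \<Rightarrow> ('v, 'e, 'k::field) free_alg" where
  "gh e \<equiv> letter (Ghost e)"

definition scale :: "'k::field \<Rightarrow> ('v, 'e, 'k) free_alg \<Rightarrow> ('v, 'e, 'k) free_alg" where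
  "scale c p = Poly_Mapping.single 0 c * p"

text \<open>
  The non-unital free algebra on the generators of \<open>G\<close>, spanned by the nonempty words. It has
  no identity element: the field \<^const>\<open>one\<close> is filled with the sum of all vertices, which becomes the
  identity in the quotient below when the graph is finite.
\<close>
definition free_algebra :: "('v, 'e) pre_digraph \<Rightarrow> ('v, 'e, 'k::field) free_alg ring" where
  "free_algebra G =
     \<lparr>carrier = {p. \<forall>w \<in> Poly_Mapping.keys p. letters w \<noteq> [] \<and> set (letters w) \<subseteq> gens G},
      mult = (*), one = (\<Sum>v\<in>verts G. vx v), zero = 0, add = (+)\<rparr>"

inductive_set leavitt_relations :: "('v, 'e) pre_digraph \<Rightarrow> ('v, 'e, 'k::field) free_alg set"
  for G :: "('v, 'e) pre_digraph" where
  vertices: "\<lbrakk>v \<in> verts G; w \<in> verts G\<rbrakk> \<Longrightarrow> vx v * vx w - (if v = w then vx w else 0) \<in> leavitt_relations G"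
| source_edge: "e \<in> arcs G \<Longrightarrow> vx (tail G e) * ed e - ed e \<in> leavitt_relations G"
| edge_range: "e \<in> arcs G \<Longrightarrow> ed e * vx (head G e) - ed e \<in> leavitt_relations G"
| range_ghost: "e \<in> arcs G \<Longrightarrow> vx (head G e) * gh e - gh e \<in> leavitt_relations G"
| ghost_source: "e \<in> arcs G \<Longrightarrow> gh e * vx (tail G e) - gh e \<in> leavitt_relations G"
| ck1: "\<lbrakk>e \<in> arcs G; f \<in> arcs G\<rbrakk> \<Longrightarrow>
    gh e * ed f - (if e = f then vx (head G e) else 0) \<in> leavitt_relations G"
| ck2: "is_regular G v \<Longrightarrow> vx v - (\<Sum>e\<in>out_arcs G v. ed e * gh e) \<in> leavitt_relations G"

text \<open>
  The two-sided algebra ideal of the non-unital free algebra generated by the relations; closure under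
  scalars has to be required separately since there is no identity.
\<close>
inductive_set leavitt_ideal :: "('v, 'e) pre_digraph \<Rightarrow> ('v, 'e, 'k::field) free_alg set"
  for G :: "('v, 'e) pre_digraph" where
  zero: "0 \<in> leavitt_ideal G"
| rel: "p \<in> leavitt_relations G \<Longrightarrow> p \<in> leavitt_ideal G"
| add: "\<lbrakk>p \<in> leavitt_ideal G; q \<in> leavitt_ideal G\<rbrakk> \<Longrightarrow> p + q \<in> leavitt_ideal G"
| scale: "p \<in> leavitt_ideal G \<Longrightarrow> scale c p \<in> leavitt_ideal G"
| mult_left: "\<lbrakk>a \<in> carrier (free_algebra G); p \<in> leavitt_ideal G\<rbrakk> \<Longrightarrow> a * p \<in> leavitt_ideal G"
| mult_right: "\<lbrakk>a \<in> carrier (free_algebra G); p \<in> leavitt_ideal G\<rbrakk> \<Longrightarrow> p * a \<in> leavitt_ideal G"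

definition leavitt_path_algebra ::
    "'k::field itself \<Rightarrow> ('v, 'e) pre_digraph \<Rightarrow> ('v, 'e, 'k) free_alg set ring" where
  "leavitt_path_algebra K G = free_algebra G Quot leavitt_ideal G"

subsection \<open>Leavitt path algebras of finite graphs are unital rings\<close>

lemma free_algebra_closed:
  assumes "p \<in> carrier (free_algebra G)" "q \<in> carrier (free_algebra G)"
  shows "p + q \<in> carrier (free_algebra G)" "p * q \<in> carrier (free_algebra G)"
    "- p \<in> carrier (free_algebra G)" "p - q \<in> carrier (free_algebra G)"
    "scale c p \<in> carrier (free_algebra G)"
proof -
  show "p + q \<in> carrier (free_algebra G)"
    using assms Poly_Mapping.keys_add[of p q] unfolding free_algebra_def by fastforce
  show "- p \<in> carrier (free_algebra G)"
    using assms by (simp add: free_algebra_def)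
  show "p - q \<in> carrier (free_algebra G)"
    using assms keys_diff[of p q] unfolding free_algebra_def by fastforce
  show "p * q \<in> carrier (free_algebra G)"
    using assms keys_mult[of p q] unfolding free_algebra_def
    by (fastforce simp: plus_word_def)
  show "scale c p \<in> carrier (free_algebra G)"
    using assms keys_mult[of "Poly_Mapping.single 0 c" p] unfolding free_algebra_def scale_def
    by (fastforce simp: plus_word_def zero_word_def split: if_splits)
qed

lemma zero_in_free_algebra: "0 \<in> carrier (free_algebra G)"
  by (simp add: free_algebra_def)

lemma letter_in_free_algebra: "g \<in> gens G \<Longrightarrow> letter g \<in> carrier (free_algebra G)"
  by (simp add: free_algebra_def letter_def)

lemma sum_in_free_algebra:
  "(\<And>i. i \<in> A \<Longrightarrow> f i \<in> carrier (free_algebra G)) \<Longrightarrow> sum f A \<in> carrier (free_algebra G)"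
  by (induction A rule: infinite_finite_induct)
    (auto simp: zero_in_free_algebra intro: free_algebra_closed)

lemma scale_minus_one: "scale (-1) p = - p"
  by (simp add: scale_def single_uminus)

lemma abelian_group_free_algebra:
  "abelian_group (free_algebra (G :: ('a, 'b) pre_digraph) :: ('a, 'b, 'c::field) free_alg ring)"
proof (rule abelian_groupI)
  fix x assume "x \<in> carrier (free_algebra G)"
  then have "- x \<in> carrier (free_algebra G)" "- x \<oplus>\<^bsub>free_algebra G\<^esub> x = \<zero>\<^bsub>free_algebra G\<^esub>"
    using free_algebra_closed(3)[of x] by (auto simp: free_algebra_def)
  then show "\<exists>y\<in>carrier (free_algebra G). y \<oplus>\<^bsub>free_algebra G\<^esub> x = \<zero>\<^bsub>free_algebra G\<^esub>" by blast
next
  fix x y :: "('a, 'b, 'c) free_alg"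
  assume "x \<in> carrier (free_algebra G)" "y \<in> carrier (free_algebra G)"
  then show "x \<oplus>\<^bsub>free_algebra G\<^esub> y \<in> carrier (free_algebra G)"
    using free_algebra_closed(1)[of x G y] by (simp add: free_algebra_def)
qed (auto simp: free_algebra_def add_ac)

context
  fixes G :: "('v, 'e) pre_digraph"
  assumes wf: "wf_digraph G"
begin

lemma leavitt_relations_subset: "leavitt_relations G \<subseteq> carrier (free_algebra G)"
proof
  interpret wf_digraph G by (fact wf)
  fix p assume "p \<in> leavitt_relations G"
  then show "p \<in> carrier (free_algebra G)"
    by cases (auto simp: gens_def is_regular_def intro!: free_algebra_closed
        zero_in_free_algebra letter_in_free_algebra sum_in_free_algebra split: if_splits)
qed

lemma leavitt_ideal_subset: "leavitt_ideal G \<subseteq> carrier (free_algebra G)"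
proof
  fix p assume "p \<in> leavitt_ideal G"
  then show "p \<in> carrier (free_algebra G)"
    by induction (use leavitt_relations_subset in
        \<open>auto intro: free_algebra_closed zero_in_free_algebra\<close>)
qed

end

lemma leavitt_ideal_uminus: "p \<in> leavitt_ideal G \<Longrightarrow> - p \<in> leavitt_ideal G"
  using leavitt_ideal.scale[of p G "-1"] by (simp add: scale_minus_one)

lemma leavitt_ideal_sum: "(\<And>i. i \<in> A \<Longrightarrow> f i \<in> leavitt_ideal G) \<Longrightarrow> sum f A \<in> leavitt_ideal G"
  by (induction A rule: infinite_finite_induct) (simp_all add: leavitt_ideal.zero leavitt_ideal.add)

lemma abelian_subgroup_leavitt_ideal:
  assumes "wf_digraph G"
  shows "abelian_subgroup (leavitt_ideal G) (free_algebra G)"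
proof (rule abelian_subgroupI3)
  interpret A: abelian_group "free_algebra G" by (rule abelian_group_free_algebra)
  have inv: "\<ominus>\<^bsub>free_algebra G\<^esub> x = - x" if "x \<in> carrier (free_algebra G)" for x
    using free_algebra_closed(3)[OF that that]
    by (intro A.minus_equality that) (auto simp: free_algebra_def)
  show "additive_subgroup (leavitt_ideal G) (free_algebra G)"
  proof (rule additive_subgroup.intro, rule subgroup.intro)
    fix x assume x: "x \<in> leavitt_ideal G"
    then have "x \<in> carrier (free_algebra G)" using leavitt_ideal_subset[OF assms] by blast
    then have "inv\<^bsub>add_monoid (free_algebra G)\<^esub> x = - x" using inv by (simp add: a_inv_def)
    then show "inv\<^bsub>add_monoid (free_algebra G)\<^esub> x \<in> leavitt_ideal G"
      using leavitt_ideal_uminus[OF x] by simp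
  qed (use leavitt_ideal_subset[OF assms] in
      \<open>auto simp: free_algebra_def intro: leavitt_ideal.zero leavitt_ideal.add\<close>)
qed (rule abelian_group_free_algebra)

lemma coset_eq_iff:
  "leavitt_ideal G +>\<^bsub>free_algebra G\<^esub> p = leavitt_ideal G +>\<^bsub>free_algebra G\<^esub> q \<longleftrightarrow> p - q \<in> leavitt_ideal G"
proof -
  have c: "x \<in> leavitt_ideal G +>\<^bsub>free_algebra G\<^esub> y \<longleftrightarrow> x - y \<in> leavitt_ideal G" for x y
    by (force simp: a_r_coset_def' free_algebra_def algebra_simps)
  show ?thesis
  proof
    assume "leavitt_ideal G +>\<^bsub>free_algebra G\<^esub> p = leavitt_ideal G +>\<^bsub>free_algebra G\<^esub> q"
    with c[of p p] c[of p q] show "p - q \<in> leavitt_ideal G" by (simp add: leavitt_ideal.zero)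
  next
    assume a: "p - q \<in> leavitt_ideal G"
    have "x - p \<in> leavitt_ideal G \<longleftrightarrow> x - q \<in> leavitt_ideal G" for x
      using leavitt_ideal.add[OF a, of "x - p"]
        leavitt_ideal.add[OF leavitt_ideal_uminus[OF a], of "x - q"] by auto
    with c show "leavitt_ideal G +>\<^bsub>free_algebra G\<^esub> p = leavitt_ideal G +>\<^bsub>free_algebra G\<^esub> q" by blast
  qed
qed

lemma in_coset_iff:
  "x \<in> leavitt_ideal G +>\<^bsub>free_algebra G\<^esub> y \<longleftrightarrow> x - y \<in> leavitt_ideal G"
  by (force simp: a_r_coset_def' free_algebra_def algebra_simps)

lemma rcoset_mult_leavitt:
  assumes "wf_digraph G" "p \<in> carrier (free_algebra G)" "q \<in> carrier (free_algebra G)"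
  shows "rcoset_mult (free_algebra G) (leavitt_ideal G)
           (leavitt_ideal G +>\<^bsub>free_algebra G\<^esub> p) (leavitt_ideal G +>\<^bsub>free_algebra G\<^esub> q)
         = leavitt_ideal G +>\<^bsub>free_algebra G\<^esub> (p * q)"
proof -
  have eq: "leavitt_ideal G +>\<^bsub>free_algebra G\<^esub> (a * b) = leavitt_ideal G +>\<^bsub>free_algebra G\<^esub> (p * q)"
    if "a - p \<in> leavitt_ideal G" "b - q \<in> leavitt_ideal G" for a b
  proof -
    have "a - p \<in> carrier (free_algebra G)"
      using that leavitt_ideal_subset[OF assms(1)] by blast
    then have a: "a \<in> carrier (free_algebra G)"
      using free_algebra_closed(1)[OF _ assms(2), of "a - p"] by simp
    have "a * b - p * q = a * (b - q) + (a - p) * q" by (simp add: algebra_simps)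
    also have "\<dots> \<in> leavitt_ideal G"
      using that a assms(3) by (intro leavitt_ideal.add leavitt_ideal.mult_left leavitt_ideal.mult_right)
    finally show ?thesis by (simp add: coset_eq_iff)
  qed
  have self: "p \<in> leavitt_ideal G +>\<^bsub>free_algebra G\<^esub> p" "q \<in> leavitt_ideal G +>\<^bsub>free_algebra G\<^esub> q"
    by (simp_all add: in_coset_iff leavitt_ideal.zero)
  have "rcoset_mult (free_algebra G) (leavitt_ideal G)
           (leavitt_ideal G +>\<^bsub>free_algebra G\<^esub> p) (leavitt_ideal G +>\<^bsub>free_algebra G\<^esub> q)
         = (\<Union>a\<in>leavitt_ideal G +>\<^bsub>free_algebra G\<^esub> p. \<Union>b\<in>leavitt_ideal G +>\<^bsub>free_algebra G\<^esub> q.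
              leavitt_ideal G +>\<^bsub>free_algebra G\<^esub> (a * b))"
    by (simp add: rcoset_mult_def free_algebra_def)
  also have "\<dots> = (\<Union>a\<in>leavitt_ideal G +>\<^bsub>free_algebra G\<^esub> p. \<Union>b\<in>leavitt_ideal G +>\<^bsub>free_algebra G\<^esub> q.
              leavitt_ideal G +>\<^bsub>free_algebra G\<^esub> (p * q))"
    by (intro SUP_cong refl eq) (simp_all only: in_coset_iff)
  also have "\<dots> = leavitt_ideal G +>\<^bsub>free_algebra G\<^esub> (p * q)" using self by blast
  finally show ?thesis .
qed

lemma vertex_sum_letter:
  fixes G :: "('v, 'e) pre_digraph" and g :: "('v, 'e) gen"
  assumes "fin_digraph G" "g \<in> gens G"
  shows "(\<Sum>v\<in>verts G. vx v) * letter g - (letter g :: ('v, 'e, 'k::field) free_alg) \<in> leavitt_ideal G"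
    and "letter g * (\<Sum>v\<in>verts G. vx v) - (letter g :: ('v, 'e, 'k::field) free_alg) \<in> leavitt_ideal G"
proof -
  interpret fin_digraph G by (fact assms(1))
  let ?I = "leavitt_ideal G :: ('v, 'e, 'k::field) free_alg set"
  let ?l = "letter g :: ('v, 'e, 'k::field) free_alg"
  have car: "?l \<in> carrier (free_algebra G)"
    using assms(2) by (rule letter_in_free_algebra)
  obtain u where u: "u \<in> verts G" "vx u * ?l - ?l \<in> ?I"
  proof -
    from assms(2) consider v where "v \<in> verts G" "g = Vertex v"
      | e where "e \<in> arcs G" "g = Edge e" | e where "e \<in> arcs G" "g = Ghost e"
      by (auto simp: gens_def)
    then show ?thesis
    proof cases
      case 1
      with leavitt_relations.vertices[of v G v] show ?thesis
        by (intro that[of v]) (auto intro: leavitt_ideal.rel)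
    next
      case 2
      then show ?thesis
        by (intro that[of "tail G e"]) (auto intro: leavitt_ideal.rel leavitt_relations.intros)
    next
      case 3
      then show ?thesis
        by (intro that[of "head G e"]) (auto intro: leavitt_ideal.rel leavitt_relations.intros)
    qed
  qed
  obtain u' where u': "u' \<in> verts G" "?l * vx u' - ?l \<in> ?I"
  proof -
    from assms(2) consider v where "v \<in> verts G" "g = Vertex v"
      | e where "e \<in> arcs G" "g = Edge e" | e where "e \<in> arcs G" "g = Ghost e"
      by (auto simp: gens_def)
    then show ?thesis
    proof cases
      case 1
      with leavitt_relations.vertices[of v G v] show ?thesis
        by (intro that[of v]) (auto intro: leavitt_ideal.rel)
    next
      case 2
      then show ?thesis
        by (intro that[of "head G e"]) (auto intro: leavitt_ideal.rel leavitt_relations.intros)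
    next
      case 3
      then show ?thesis
        by (intro that[of "tail G e"]) (auto intro: leavitt_ideal.rel leavitt_relations.intros)
    qed
  qed
  have orth: "vx v * vx w \<in> ?I" if "v \<in> verts G" "w \<in> verts G" "v \<noteq> w" for v w
    using leavitt_ideal.rel[OF leavitt_relations.vertices[OF that(1,2)]] that(3) by simp
  have vc: "vx v \<in> carrier (free_algebra G)" if "v \<in> verts G" for v
    using that by (intro letter_in_free_algebra) (auto simp: gens_def)
  have oth: "vx v * ?l \<in> ?I" if "v \<in> verts G - {u}" for v
  proof -
    have "vx v * ?l = vx v * vx u * ?l + - (vx v * (vx u * ?l - ?l))"
      by (simp add: algebra_simps)
    also have "\<dots> \<in> ?I"
      using that u vc[of v] car orth[of v u]
      by (blast intro: leavitt_ideal.add leavitt_ideal_uminus leavitt_ideal.mult_left leavitt_ideal.mult_right)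
    finally show ?thesis .
  qed
  have oth': "?l * vx v \<in> ?I" if "v \<in> verts G - {u'}" for v
  proof -
    have "?l * vx v = ?l * (vx u' * vx v) + - ((?l * vx u' - ?l) * vx v)"
      by (simp add: algebra_simps)
    also have "\<dots> \<in> ?I"
      using that u' vc[of v] car orth[of u' v]
      by (blast intro: leavitt_ideal.add leavitt_ideal_uminus leavitt_ideal.mult_left leavitt_ideal.mult_right)
    finally show ?thesis .
  qed
  have "(\<Sum>v\<in>verts G. vx v) * ?l - ?l = (vx u * ?l - ?l) + (\<Sum>v\<in>verts G - {u}. vx v * ?l)"
    using u(1) by (simp add: sum.remove[of _ u] distrib_right sum_distrib_right)
  also have "\<dots> \<in> ?I" using u oth by (intro leavitt_ideal.add leavitt_ideal_sum)
  finally show "(\<Sum>v\<in>verts G. vx v) * ?l - ?l \<in> ?I" .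
  have "?l * (\<Sum>v\<in>verts G. vx v) - ?l = (?l * vx u' - ?l) + (\<Sum>v\<in>verts G - {u'}. ?l * vx v)"
    using u'(1) by (simp add: sum.remove[of _ u'] distrib_left sum_distrib_left)
  also have "\<dots> \<in> ?I" using u' oth' by (intro leavitt_ideal.add leavitt_ideal_sum)
  finally show "?l * (\<Sum>v\<in>verts G. vx v) - ?l \<in> ?I" .
qed

lemma single_word_Cons:
  "Poly_Mapping.single (Word (g # gs)) c = letter g * Poly_Mapping.single (Word gs) c"
  "Poly_Mapping.single (Word (gs @ [g])) c = Poly_Mapping.single (Word gs) c * letter g"
  by (simp_all add: letter_def mult_single plus_word_def)

lemma vertex_sum_single:
  fixes G :: "('v, 'e) pre_digraph" and c :: "'k::field"
  assumes G: "fin_digraph G" and w: "ws \<noteq> []" "set ws \<subseteq> gens G"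
  shows "(\<Sum>v\<in>verts G. vx v) * Poly_Mapping.single (Word ws) c - Poly_Mapping.single (Word ws) c \<in> leavitt_ideal G"
    and "Poly_Mapping.single (Word ws) c * (\<Sum>v\<in>verts G. vx v) - Poly_Mapping.single (Word ws) c \<in> leavitt_ideal G"
proof -
  let ?I = "leavitt_ideal G :: ('v, 'e, 'k) free_alg set"
  let ?s = "(\<Sum>v\<in>verts G. vx v) :: ('v, 'e, 'k) free_alg"
  have car: "Poly_Mapping.single (Word us) c \<in> carrier (free_algebra G)"
    if "us \<noteq> []" "set us \<subseteq> gens G" for us and c :: 'k
    using that by (simp add: free_algebra_def)
  obtain g gs where gs: "ws = g # gs" using w by (cases ws) auto
  have g: "?s * letter g - letter g \<in> ?I" using vertex_sum_letter(1)[OF G] gs w by auto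
  show "?s * Poly_Mapping.single (Word ws) c - Poly_Mapping.single (Word ws) c \<in> ?I"
  proof (cases "gs = []")
    case True
    have "scale c (?s * letter g - letter g) \<in> ?I" by (rule leavitt_ideal.scale[OF g])
    moreover have "Poly_Mapping.single (Word [g]) c = scale c (letter g)"
      by (simp add: scale_def letter_def mult_single)
    moreover have "?s * scale c (letter g) = scale c (?s * letter g)"
      by (simp add: scale_def letter_def sum_distrib_left sum_distrib_right mult_single)
    ultimately show ?thesis using True gs by (simp add: scale_def algebra_simps)
  next
    case False
    have "(?s * letter g - letter g) * Poly_Mapping.single (Word gs) c \<in> ?I"
      using gs w False g car[of gs] by (intro leavitt_ideal.mult_right) auto
    then show ?thesis by (simp add: gs single_word_Cons algebra_simps)
  qed
  obtain h hs where hs: "ws = hs @ [h]" using w by (cases ws rule: rev_cases) auto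
  have h: "letter h * ?s - letter h \<in> ?I" using vertex_sum_letter(2)[OF G] hs w by auto
  show "Poly_Mapping.single (Word ws) c * ?s - Poly_Mapping.single (Word ws) c \<in> ?I"
  proof (cases "hs = []")
    case True
    have "scale c (letter h * ?s - letter h) \<in> ?I" by (rule leavitt_ideal.scale[OF h])
    moreover have "Poly_Mapping.single (Word [h]) c = scale c (letter h)"
      by (simp add: scale_def letter_def mult_single)
    ultimately show ?thesis using True hs by (simp add: scale_def algebra_simps)
  next
    case False
    have "Poly_Mapping.single (Word hs) c * (letter h * ?s - letter h) \<in> ?I"
      using hs w False h car[of hs] by (intro leavitt_ideal.mult_left) auto
    then show ?thesis by (simp only: hs single_word_Cons algebra_simps)
  qed
qed

lemma vertex_sum_neutral:
  fixes G :: "('v, 'e) pre_digraph" and p :: "('v, 'e, 'k::field) free_alg"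
  assumes G: "fin_digraph G" and p: "p \<in> carrier (free_algebra G)"
  shows "(\<Sum>v\<in>verts G. vx v) * p - p \<in> leavitt_ideal G"
    and "p * (\<Sum>v\<in>verts G. vx v) - p \<in> leavitt_ideal G"
proof -
  let ?I = "leavitt_ideal G :: ('v, 'e, 'k) free_alg set"
  let ?s = "(\<Sum>v\<in>verts G. vx v) :: ('v, 'e, 'k) free_alg"
  let ?m = "\<lambda>w. Poly_Mapping.single w (Poly_Mapping.lookup p w)"
  have p_eq: "p = (\<Sum>w\<in>Poly_Mapping.keys p. ?m w)"
    by (rule poly_mapping_eqI)
      (simp add: lookup_sum lookup_single when_def in_keys_iff)
  have m: "?s * ?m w - ?m w \<in> ?I" "?m w * ?s - ?m w \<in> ?I" if "w \<in> Poly_Mapping.keys p" for w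
    using vertex_sum_single[OF G, of "letters w" "Poly_Mapping.lookup p w"] p that
    by (auto simp: free_algebra_def)
  have "?s * p - p = (\<Sum>w\<in>Poly_Mapping.keys p. ?s * ?m w - ?m w)"
    by (subst p_eq, subst (2) p_eq) (simp only: sum_subtractf sum_distrib_left)
  also have "\<dots> \<in> ?I" using m by (intro leavitt_ideal_sum)
  finally show "?s * p - p \<in> ?I" .
  have "p * ?s - p = (\<Sum>w\<in>Poly_Mapping.keys p. ?m w * ?s - ?m w)"
    by (subst p_eq, subst (2) p_eq) (simp only: sum_subtractf sum_distrib_right)
  also have "\<dots> \<in> ?I" using m by (intro leavitt_ideal_sum)
  finally show "p * ?s - p \<in> ?I" .
qed

theorem ring_leavitt_path_algebra:
  fixes G :: "('v, 'e) pre_digraph" and K :: "'k::field itself"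
  assumes G: "fin_digraph G"
  shows "ring (leavitt_path_algebra K G)"
proof -
  interpret fin_digraph G by (fact G)
  let ?F = "free_algebra G :: ('v, 'e, 'k) free_alg ring"
  let ?I = "leavitt_ideal G :: ('v, 'e, 'k) free_alg set"
  interpret A: abelian_subgroup ?I ?F
    by (rule abelian_subgroup_leavitt_ideal) unfold_locales
  note rm = rcoset_mult_leavitt[OF wf_digraph]
  have fs: "mult ?F = (*)" "add ?F = (+)" "one ?F = (\<Sum>v\<in>verts G. vx v)"
    by (simp_all add: free_algebra_def)
  have s: "(\<Sum>v\<in>verts G. vx v) \<in> carrier ?F"
    by (intro sum_in_free_algebra letter_in_free_algebra) (auto simp: gens_def)
  have add: "(?I +>\<^bsub>?F\<^esub> p) <+>\<^bsub>?F\<^esub> (?I +>\<^bsub>?F\<^esub> q) = ?I +>\<^bsub>?F\<^esub> (p + q)"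
    if "p \<in> carrier ?F" "q \<in> carrier ?F" for p q
    using A.a_rcos_sum[OF that] by (simp add: fs)
  have qs: "carrier (?F Quot ?I) = (\<lambda>x. ?I +>\<^bsub>?F\<^esub> x) ` carrier ?F"
    "mult (?F Quot ?I) = rcoset_mult ?F ?I" "add (?F Quot ?I) = set_add ?F"
    "one (?F Quot ?I) = ?I +>\<^bsub>?F\<^esub> (\<Sum>v\<in>verts G. vx v)"
    by (auto simp: FactRing_def A_RCOSETS_def RCOSETS_def a_r_coset_def fs)
  have "ring (?F Quot ?I)"
  proof (rule ringI)
    show "abelian_group (?F Quot ?I)"
      by (rule comm_group_abelian_groupI)
        (simp add: FactRing_def A.a_factorgroup_is_comm_group[unfolded A_FactGroup_def'])
    show "Group.monoid (?F Quot ?I)"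
      by (rule monoidI)
        (auto simp: qs rm s free_algebra_closed mult.assoc
          coset_eq_iff[THEN iffD2, OF vertex_sum_neutral(1)[OF G]]
          coset_eq_iff[THEN iffD2, OF vertex_sum_neutral(2)[OF G]])
  qed (auto simp: qs rm add free_algebra_closed distrib_left distrib_right)
  then show ?thesis by (simp add: leavitt_path_algebra_def)
qed

section \<open>Invariant Basis Number\<close>

definition free_right_module :: "('a, 'b) ring_scheme \<Rightarrow> nat \<Rightarrow> (nat \<Rightarrow> 'a) set" where
  "free_right_module R n = {..<n} \<rightarrow>\<^sub>E carrier R"

definition fm_add :: "('a, 'b) ring_scheme \<Rightarrow> nat \<Rightarrow> (nat \<Rightarrow> 'a) \<Rightarrow> (nat \<Rightarrow> 'a) \<Rightarrow> nat \<Rightarrow> 'a" where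
  "fm_add R n x y = (\<lambda>i\<in>{..<n}. x i \<oplus>\<^bsub>R\<^esub> y i)"

definition fm_smult :: "('a, 'b) ring_scheme \<Rightarrow> nat \<Rightarrow> (nat \<Rightarrow> 'a) \<Rightarrow> 'a \<Rightarrow> nat \<Rightarrow> 'a" where
  "fm_smult R n x r = (\<lambda>i\<in>{..<n}. x i \<otimes>\<^bsub>R\<^esub> r)"

definition free_right_module_iso ::
    "('a, 'b) ring_scheme \<Rightarrow> nat \<Rightarrow> nat \<Rightarrow> ((nat \<Rightarrow> 'a) \<Rightarrow> (nat \<Rightarrow> 'a)) \<Rightarrow> bool" where
  "free_right_module_iso R m n \<phi> \<longleftrightarrow>
     bij_betw \<phi> (free_right_module R m) (free_right_module R n) \<and>
     (\<forall>x \<in> free_right_module R m. \<forall>y \<in> free_right_module R m.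
        \<phi> (fm_add R m x y) = fm_add R n (\<phi> x) (\<phi> y)) \<and>
     (\<forall>x \<in> free_right_module R m. \<forall>r \<in> carrier R.
        \<phi> (fm_smult R m x r) = fm_smult R n (\<phi> x) r)"

definition invariant_basis_number :: "('a, 'b) ring_scheme \<Rightarrow> bool" where
  "invariant_basis_number R \<longleftrightarrow>
     (\<forall>m n. m > 0 \<longrightarrow> n > 0 \<longrightarrow> (\<exists>\<phi>. free_right_module_iso R m n \<phi>) \<longrightarrow> m = n)"

end

theory Submission
  imports Defs "HOL-Library.Function_Algebras"
begin

text \<open>
  A function \<open>d\<close> from the vertices to the natural numbers with \<open>d v = (\<Sum>e. d (r e))\<close>, summed over
  the edges leaving \<open>v\<close>, for every regular \<open>v\<close> is the dimension vector of a finite-dimensional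
  representation of the Leavitt path algebra: the edges leaving \<open>v\<close> identify a vector space of
  dimension \<open>d v\<close> with the direct sum of spaces of dimensions \<open>d (r e)\<close>. If \<open>d \<noteq> 0\<close>, this is a unital
  homomorphism into a nonzero matrix ring over the field, hence the algebra has invariant basis
  number. The indicator function of an isolated vertex, or of the vertices of a source cycle, is such a
  function, and it extends backwards along each source elimination, because the value at the
  eliminated source is prescribed by the values at its out-neighbours and occurs in no other equation.
\<close>

section \<open>Invariant basis number from a matrix representation\<close>

text \<open>The columns of \<open>P\<close> span all unit vectors indexed by \<open>I\<close>, with
  the entries of \<open>Q\<close> as coefficients, and an independent set is no larger than a finite
  spanning set.\<close>

lemma card_le_if_matrix_right_inverse:
  fixes P :: "'i \<Rightarrow> 'j \<Rightarrow> 'k::field" and Q :: "'j \<Rightarrow> 'i \<Rightarrow> 'k"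
  assumes "finite I" "finite J"
    and PQ: "\<And>i k. i \<in> I \<Longrightarrow> k \<in> I \<Longrightarrow> (\<Sum>j\<in>J. P i j * Q j k) = (if i = k then 1 else 0)"
  shows "card I \<le> card J"
proof -
  interpret V: vector_space "\<lambda>(c::'k) (f::'i \<Rightarrow> 'k) i. c * f i"
    by unfold_locales (auto simp: fun_eq_iff algebra_simps)
  have sum_apply: "(\<Sum>x\<in>A. f x) i = (\<Sum>x\<in>A. f x i)" for A and f :: "'x \<Rightarrow> 'i \<Rightarrow> 'k" and i
    by (induction A rule: infinite_finite_induct) auto
  define u :: "'i \<Rightarrow> 'i \<Rightarrow> 'k" where "u k = (\<lambda>i. if i = k then 1 else 0)" for k
  \<comment> \<open>The columns are cut off outside \<open>I\<close>, so that the combination agrees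
    with the unit vector at every index; \<open>PQ\<close> speaks only of indices in
    \<open>I\<close>.\<close>
  define C where "C j = (\<lambda>i. if i \<in> I then P i j else 0)" for j
  have inj: "inj_on u I"
    by (rule inj_onI) (metis u_def zero_neq_one)
  have "V.independent (u ` I)"
  proof (rule V.independent_if_scalars_zero)
    show "finite (u ` I)" using \<open>finite I\<close> by simp
    fix f x assume f: "(\<Sum>x\<in>u ` I. (\<lambda>i. f x * x i)) = 0" and "x \<in> u ` I"
    then obtain k where k: "k \<in> I" "x = u k" by blast
    have "0 = (\<Sum>x\<in>u ` I. (\<lambda>i. f x * x i)) k" by (simp add: f)
    also have "\<dots> = (\<Sum>j\<in>I. f (u j) * u j k)"
      by (simp add: sum_apply sum.reindex[OF inj])
    also have "\<dots> = f x"
      using k \<open>finite I\<close> by (simp add: u_def if_distrib cong: if_cong)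
    finally show "f x = 0" by simp
  qed
  moreover have "u ` I \<subseteq> V.span (C ` J)"
  proof (clarify)
    fix k assume k: "k \<in> I"
    have "u k = (\<Sum>j\<in>J. (\<lambda>i. Q j k * C j i))"
    proof
      fix i
      show "u k i = (\<Sum>j\<in>J. (\<lambda>i. Q j k * C j i)) i"
        using PQ[of i k] k by (cases "i \<in> I") (auto simp: sum_apply u_def C_def mult.commute)
    qed
    also have "\<dots> \<in> V.span (C ` J)"
      by (intro V.span_sum V.span_scale V.span_base) auto
    finally show "u k \<in> V.span (C ` J)" .
  qed
  ultimately have "card (u ` I) \<le> card (C ` J)"
    using V.independent_span_bound[of "C ` J" "u ` I"] \<open>finite J\<close> by simp
  also have "\<dots> \<le> card J" by (rule card_image_le[OF \<open>finite J\<close>])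
  finally show ?thesis by (simp add: card_image[OF inj])
qed

text \<open>This supplies the symmetry by which one inequality between ranks yields the
  other.\<close>

lemma free_right_module_iso_inv:
  assumes "ring R" and iso: "free_right_module_iso R m n \<phi>"
  shows "free_right_module_iso R n m (inv_into (free_right_module R m) \<phi>)"
proof -
  interpret ring R by fact
  let ?M = "free_right_module R m" and ?N = "free_right_module R n"
  let ?\<psi> = "inv_into ?M \<phi>"
  have bij: "bij_betw \<phi> ?M ?N"
    and add: "\<And>x y. x \<in> ?M \<Longrightarrow> y \<in> ?M \<Longrightarrow> \<phi> (fm_add R m x y) = fm_add R n (\<phi> x) (\<phi> y)"
    and smult: "\<And>x r. x \<in> ?M \<Longrightarrow> r \<in> carrier R \<Longrightarrow> \<phi> (fm_smult R m x r) = fm_smult R n (\<phi> x) r"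
    using iso by (auto simp: free_right_module_iso_def)
  have \<psi>: "?\<psi> x \<in> ?M" "\<phi> (?\<psi> x) = x" if "x \<in> ?N" for x
    using that bij by (auto simp: bij_betw_def inv_into_into f_inv_into_f)
  have \<psi>_eq: "?\<psi> (\<phi> x) = x" if "x \<in> ?M" for x
    using that bij by (simp add: bij_betw_def)
  have closed: "fm_add R m x y \<in> ?M" "r \<in> carrier R \<Longrightarrow> fm_smult R m x r \<in> ?M"
    if "x \<in> ?M" "y \<in> ?M" for x y r
    using that by (auto simp: fm_add_def fm_smult_def free_right_module_def)
  show ?thesis
    unfolding free_right_module_iso_def
  proof (intro conjI ballI)
    show "bij_betw ?\<psi> ?N ?M" by (rule bij_betw_inv_into[OF bij])
  next
    fix x y assume "x \<in> ?N" "y \<in> ?N"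
    then show "?\<psi> (fm_add R n x y) = fm_add R m (?\<psi> x) (?\<psi> y)"
      using add[of "?\<psi> x" "?\<psi> y"] \<psi> \<psi>_eq closed(1) by metis
  next
    fix x r assume "x \<in> ?N" "r \<in> carrier R"
    then show "?\<psi> (fm_smult R n x r) = fm_smult R m (?\<psi> x) r"
      using smult[of "?\<psi> x" r] \<psi> \<psi>_eq closed(2) by metis
  qed
qed

section \<open>Comparison of ranks under a matrix representation\<close>

text \<open>A unital ring homomorphism into the \<open>B\<close>-by-\<open>B\<close> matrices over a
  field, written entrywise. Values of \<open>h\<close> at indices outside \<open>B\<close> are
  arbitrary.\<close>

locale matrix_representation = ring R
  for R :: "('a, 'r) ring_scheme" (structure) +
  fixes B :: "'b set" and h :: "'a \<Rightarrow> 'b \<Rightarrow> 'b \<Rightarrow> 'k::field"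
  assumes finite_B: "finite B"
    and h_add: "\<lbrakk>x \<in> carrier R; y \<in> carrier R; b \<in> B; d \<in> B\<rbrakk> \<Longrightarrow> h (x \<oplus> y) b d = h x b d + h y b d"
    and h_mult: "\<lbrakk>x \<in> carrier R; y \<in> carrier R; b \<in> B; d \<in> B\<rbrakk> \<Longrightarrow>
      h (x \<otimes> y) b d = (\<Sum>c\<in>B. h x b c * h y c d)"
    and h_one: "\<lbrakk>b \<in> B; d \<in> B\<rbrakk> \<Longrightarrow> h \<one> b d = (if b = d then 1 else 0)"
begin

lemma h_zero: "\<lbrakk>b \<in> B; d \<in> B\<rbrakk> \<Longrightarrow> h \<zero> b d = 0"
  using h_add[of \<zero> \<zero> b d] by (metis add_cancel_right_right l_zero zero_closed)

definition unit_vector :: "nat \<Rightarrow> nat \<Rightarrow> nat \<Rightarrow> 'a" where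
  "unit_vector m j = (\<lambda>l\<in>{..<m}. if l = j then \<one> else \<zero>)"

lemma unit_vector_closed: "unit_vector m j \<in> free_right_module R m"
  by (auto simp: unit_vector_def free_right_module_def)

text \<open>Since \<open>x\<close> is the sum of the unit vectors times its coordinates, \<phi> is
  left multiplication by the matrix with columns \<open>\<phi> (unit_vector m j)\<close>. Applying
  \<open>h\<close> to its entries gives a block matrix over the field.\<close>

lemma h_free_right_module_iso:
  assumes iso: "free_right_module_iso R m n \<phi>" and x: "x \<in> free_right_module R m"
    and i: "i < n" and b: "b \<in> B" and d: "d \<in> B"
  shows "h (\<phi> x i) b d = (\<Sum>j<m. \<Sum>c\<in>B. h (\<phi> (unit_vector m j) i) b c * h (x j) c d)"
proof -
  let ?M = "free_right_module R m" and ?N = "free_right_module R n"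
  have mem: "\<And>x. x \<in> ?M \<Longrightarrow> \<phi> x \<in> ?N"
    and add: "\<And>x y. x \<in> ?M \<Longrightarrow> y \<in> ?M \<Longrightarrow> \<phi> (fm_add R m x y) = fm_add R n (\<phi> x) (\<phi> y)"
    and smult: "\<And>x r. x \<in> ?M \<Longrightarrow> r \<in> carrier R \<Longrightarrow> \<phi> (fm_smult R m x r) = fm_smult R n (\<phi> x) r"
    using iso by (auto simp: free_right_module_iso_def bij_betw_def)
  have comp: "\<phi> y i \<in> carrier R" if "y \<in> ?M" for y
    using mem[OF that] i by (auto simp: free_right_module_def)
  have xj: "x j \<in> carrier R" if "j < m" for j
    using x that by (auto simp: free_right_module_def)
  \<comment> \<open>\<open>T k\<close> is the partial sum of the first \<open>k\<close> terms in the
    expansion of \<open>x\<close>, so the induction adds one unit vector at a time.\<close>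
  define T where "T k = (\<lambda>l\<in>{..<m}. if l < k then x l else \<zero>)" for k
  have T_closed: "T k \<in> ?M" for k
    using xj by (auto simp: T_def free_right_module_def)
  have "h (\<phi> (T k) i) b d = (\<Sum>j<k. \<Sum>c\<in>B. h (\<phi> (unit_vector m j) i) b c * h (x j) c d)"
    if "k \<le> m" for k
    using that
  proof (induction k)
    case 0
    \<comment> \<open>The zero vector is its own multiple by the scalar zero; hence \<phi> sends it
      to zero.\<close>
    have "T 0 = fm_smult R m (T 0) \<zero>"
      by (auto simp: T_def fm_smult_def fun_eq_iff)
    then have "\<phi> (T 0) i = fm_smult R n (\<phi> (T 0)) \<zero> i"
      using smult[OF T_closed zero_closed, of 0] by simp
    then show ?case
      using i b d comp[OF T_closed] by (simp add: fm_smult_def h_zero)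
  next
    case (Suc k)
    then have k: "k < m" by simp
    let ?e = "unit_vector m k"
    have e: "fm_smult R m ?e (x k) \<in> ?M"
      using xj[OF k] by (auto simp: fm_smult_def unit_vector_def free_right_module_def)
    have "T (Suc k) = fm_add R m (T k) (fm_smult R m ?e (x k))"
      using xj k by (fastforce simp: T_def fm_add_def fm_smult_def unit_vector_def less_Suc_eq fun_eq_iff)
    then have "\<phi> (T (Suc k)) i = \<phi> (T k) i \<oplus> \<phi> ?e i \<otimes> x k"
      using i by (simp only: add[OF T_closed e] smult[OF unit_vector_closed xj[OF k]])
        (simp add: fm_add_def fm_smult_def)
    then show ?case
      using Suc b d xj[OF k] comp[OF T_closed] comp[OF unit_vector_closed]
      by (simp add: h_add h_mult)
  qed
  moreover have "T m = x"
    using x by (auto simp: T_def free_right_module_def fun_eq_iff PiE_def extensional_def)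
  ultimately show ?thesis by auto
qed

text \<open>The block matrix of \<phi> over the field has \<open>n * card B\<close> rows,
  \<open>m * card B\<close> columns and a right inverse, namely the block matrix of the inverse of
  \<phi>.\<close>

lemma rank_le:
  assumes iso: "free_right_module_iso R m n \<phi>"
  shows "n * card B \<le> m * card B"
proof -
  \<comment> \<open>The preimage of the \<open>k\<close>-th unit vector is the \<open>k\<close>-th
    column of the inverse matrix.\<close>
  let ?y = "\<lambda>k. inv_into (free_right_module R m) \<phi> (unit_vector n k)"
  have y: "?y k \<in> free_right_module R m" "\<phi> (?y k) = unit_vector n k" for k
    using iso unit_vector_closed[of n k]
    by (auto simp: free_right_module_iso_def bij_betw_def inv_into_into f_inv_into_f)
  have "card ({..<n} \<times> B) \<le> card ({..<m} \<times> B)"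
  proof (rule card_le_if_matrix_right_inverse)
    fix p q assume "p \<in> {..<n} \<times> B" "q \<in> {..<n} \<times> B"
    then obtain i b k d where
      *: "p = (i, b)" "q = (k, d)" "i < n" "k < n" "b \<in> B" "d \<in> B" by blast
    have "(\<Sum>(j, c)\<in>{..<m} \<times> B. h (\<phi> (unit_vector m j) i) b c * h (?y k j) c d) = h (\<phi> (?y k) i) b d"
      using * by (simp add: h_free_right_module_iso[OF iso y(1)] sum.cartesian_product)
    also have "\<dots> = (if p = q then 1 else 0)"
      unfolding y(2) using * by (auto simp: unit_vector_def h_one h_zero)
    finally show "(\<Sum>z\<in>{..<m} \<times> B. (case p of (i, b) \<Rightarrow> \<lambda>(j, c). h (\<phi> (unit_vector m j) i) b c) z *
        (case z of (j, c) \<Rightarrow> \<lambda>(k, d). h (?y k j) c d) q) = (if p = q then 1 else 0)"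
      using * by (simp add: case_prod_unfold)
  qed (simp_all add: finite_B)
  then show ?thesis by (simp only: card_cartesian_product card_lessThan)
qed

theorem invariant_basis_number:
  assumes "B \<noteq> {}"
  shows "invariant_basis_number R"
  unfolding invariant_basis_number_def
proof (intro allI impI)
  fix m n assume "\<exists>\<phi>. free_right_module_iso R m n \<phi>"
  then obtain \<phi> where iso: "free_right_module_iso R m n \<phi>" by blast
  have "card B > 0" using assms finite_B by (simp add: card_gt_0_iff)
  with rank_le[OF iso] rank_le[OF free_right_module_iso_inv[OF ring_axioms iso]]
  show "m = n" by simp
qed

end

section \<open>Permutative representations of Leavitt path algebras\<close>

text \<open>Each generator acts on the space with basis \<open>B\<close> by a matrix of zeros and
  ones with at most one 1 per column; \<open>None\<close> means that the basis vector is sent to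
  zero.\<close>

locale partial_action =
  fixes B :: "'b set" and act :: "('v, 'e) gen \<Rightarrow> 'b \<Rightarrow> 'b option"
  assumes finite_B: "finite B"
    and act_closed: "\<lbrakk>act g d = Some b; d \<in> B\<rbrakk> \<Longrightarrow> b \<in> B"
begin

text \<open>The last letter acts first, in accordance with the product of matrices acting on
  columns.\<close>

fun word_act :: "('v, 'e) gen list \<Rightarrow> 'b \<Rightarrow> 'b option" where
  "word_act [] = Some"
| "word_act (g # gs) = act g \<circ>\<^sub>m word_act gs"

lemma word_act_append: "word_act (us @ ws) = word_act us \<circ>\<^sub>m word_act ws"
  by (induction us) (auto simp: map_comp_def fun_eq_iff split: option.splits)

lemma word_act_closed: "\<lbrakk>word_act gs d = Some b; d \<in> B\<rbrakk> \<Longrightarrow> b \<in> B"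
  by (induction gs arbitrary: b) (auto simp: map_comp_Some_iff intro: act_closed)

text \<open>The linear extension of \<open>word_act\<close>, with row \<open>b\<close> and column
  \<open>d\<close>. The empty word acts as the identity, so \<open>scale\<close> becomes
  multiplication by a scalar matrix.\<close>

definition mat :: "('v, 'e, 'k::field) free_alg \<Rightarrow> 'b \<Rightarrow> 'b \<Rightarrow> 'k" where
  "mat p b d = (\<Sum>w\<in>Poly_Mapping.keys p.
     Poly_Mapping.lookup p w * of_bool (word_act (letters w) d = Some b))"

lemma mat_zero: "mat 0 b d = 0"
  by (simp add: mat_def)

lemma mat_add: "mat (p + q) b d = mat p b d + mat q b d"
  unfolding mat_def by (rule setsum_keys_plus_distrib) (simp_all add: algebra_simps)

lemma mat_diff: "mat (p - q) b d = mat p b d - mat q b d"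
  using mat_add[of "p - q" q b d] by simp

lemma mat_sum: "mat (sum f A) b d = (\<Sum>i\<in>A. mat (f i) b d)"
  by (induction A rule: infinite_finite_induct) (simp_all add: mat_zero mat_add)

lemma mat_single:
  "mat (Poly_Mapping.single w c) b d = c * of_bool (word_act (letters w) d = Some b)"
  by (simp add: mat_def)

lemma mat_letter: "mat (letter g) b d = of_bool (act g d = Some b)"
  by (simp add: letter_def mat_single map_comp_def)

lemma mat_letter_mult:
  "mat (letter f * letter g) b d = of_bool ((act f \<circ>\<^sub>m act g) d = Some b)"
  by (simp add: letter_def mult_single mat_single plus_word_def map_comp_def)

text \<open>By bilinearity it is enough to treat two words. There at most one intermediate index
  \<open>c\<close> contributes, the image of \<open>d\<close> under the second word, and it lies in
  \<open>B\<close> because \<open>d\<close> does.\<close>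

lemma mat_mult:
  fixes p q :: "('v, 'e, 'k::field) free_alg"
  assumes "d \<in> B"
  shows "mat (p * q) b d = (\<Sum>c\<in>B. mat p b c * mat q c d)"
proof -
  have decomp: "p = (\<Sum>w\<in>Poly_Mapping.keys p. Poly_Mapping.single w (Poly_Mapping.lookup p w))"
    for p :: "('v, 'e, 'k) free_alg"
    by (rule poly_mapping_eqI) (simp add: lookup_sum lookup_single when_def in_keys_iff)
  have of_bool_comp: "of_bool (word_act (us @ ws) d = Some b)
      = (\<Sum>c\<in>B. of_bool (word_act us c = Some b) * of_bool (word_act ws d = Some c) :: 'k)" for us ws
  proof (cases "word_act ws d")
    case (Some a)
    then have "a \<in> B" using word_act_closed assms by blast
    with Some finite_B show ?thesis
      by (simp add: word_act_append sum.remove[of B a])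
  qed (simp add: word_act_append)
  have single: "mat (Poly_Mapping.single u x * Poly_Mapping.single w y) b d
      = (\<Sum>c\<in>B. mat (Poly_Mapping.single u x) b c * mat (Poly_Mapping.single w y) c d)"
    for u w and x y :: 'k
    by (simp add: mult_single mat_single plus_word_def of_bool_comp sum_distrib_left mult_ac)
  let ?s = "\<lambda>p w. Poly_Mapping.single w (Poly_Mapping.lookup p w)"
  have mat_decomp: "mat p b c = (\<Sum>w\<in>Poly_Mapping.keys p. mat (?s p w) b c)"
    for p :: "('v, 'e, 'k) free_alg" and b c
    using arg_cong[OF decomp[of p], of "\<lambda>p. mat p b c"] by (simp only: mat_sum)
  have "mat (p * q) b d = (\<Sum>u\<in>Poly_Mapping.keys p. \<Sum>w\<in>Poly_Mapping.keys q. mat (?s p u * ?s q w) b d)"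
    by (subst decomp[of p], subst decomp[of q]) (simp only: sum_product mat_sum)
  also have "\<dots> = (\<Sum>u\<in>Poly_Mapping.keys p. \<Sum>c\<in>B. \<Sum>w\<in>Poly_Mapping.keys q. mat (?s p u) b c * mat (?s q w) c d)"
    by (simp only: single sum.swap[of _ B])
  also have "\<dots> = (\<Sum>c\<in>B. \<Sum>u\<in>Poly_Mapping.keys p. \<Sum>w\<in>Poly_Mapping.keys q. mat (?s p u) b c * mat (?s q w) c d)"
    by (rule sum.swap)
  also have "\<dots> = (\<Sum>c\<in>B. mat p b c * mat q c d)"
    by (simp only: mat_decomp[of p] mat_decomp[of q] sum_product)
  finally show ?thesis .
qed

end

section \<open>Descent of the action to the Leavitt path algebra\<close>

locale leavitt_action = partial_action B act + fin_digraph G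
  for G :: "('v, 'e) pre_digraph" and B :: "'b set" and act :: "('v, 'e) gen \<Rightarrow> 'b \<Rightarrow> 'b option" +
  fixes K :: "'k::field itself"
  assumes mat_relation:
      "\<And>(p :: ('v, 'e, 'k) free_alg) b d. \<lbrakk>p \<in> leavitt_relations G; b \<in> B; d \<in> B\<rbrakk> \<Longrightarrow> mat p b d = 0"
    and mat_vertex_sum:
      "\<And>b d. \<lbrakk>b \<in> B; d \<in> B\<rbrakk> \<Longrightarrow> mat (\<Sum>v\<in>verts G. vx v :: ('v, 'e, 'k) free_alg) b d = of_bool (b = d)"
begin

text \<open>Products stay zero because \<open>mat_mult\<close> sums only over indices in
  \<open>B\<close>, where the induction hypothesis applies; scaling is a product with a multiple of
  the empty word.\<close>

lemma mat_ideal: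
  fixes p :: "('v, 'e, 'k) free_alg"
  assumes "p \<in> leavitt_ideal G" "b \<in> B" "d \<in> B"
  shows "mat p b d = 0"
  using assms
  by (induction arbitrary: b d rule: leavitt_ideal.induct)
    (simp_all add: mat_zero mat_relation mat_add mat_mult scale_def)

abbreviation coset :: "('v, 'e, 'k) free_alg \<Rightarrow> ('v, 'e, 'k) free_alg set" where
  "coset p \<equiv> leavitt_ideal G +>\<^bsub>free_algebra G\<^esub> p"

text \<open>Any representative serves: two of them differ by an element of the ideal, whose entries
  over \<open>B\<close> vanish.\<close>

definition coset_mat :: "('v, 'e, 'k) free_alg set \<Rightarrow> 'b \<Rightarrow> 'b \<Rightarrow> 'k" where
  "coset_mat X = mat (SOME p. p \<in> X)"

lemma coset_mat_coset:
  assumes "b \<in> B" "d \<in> B"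
  shows "coset_mat (coset p) b d = mat p b d"
proof -
  have "p \<in> coset p" by (simp add: in_coset_iff leavitt_ideal.zero)
  then have "(SOME q. q \<in> coset p) \<in> coset p" by (rule someI)
  then have "(SOME q. q \<in> coset p) - p \<in> leavitt_ideal G" by (simp only: in_coset_iff)
  from mat_ideal[OF this assms] show ?thesis by (simp add: coset_mat_def mat_diff)
qed

lemma matrix_representation_leavitt:
  "matrix_representation (leavitt_path_algebra K G) B coset_mat"
proof -
  let ?F = "free_algebra G :: ('v, 'e, 'k) free_alg ring"
  interpret R: ring "leavitt_path_algebra K G"
    by (rule ring_leavitt_path_algebra[OF fin_digraph])
  interpret A: abelian_subgroup "leavitt_ideal G" ?F
    by (rule abelian_subgroup_leavitt_ideal[OF wf_digraph])
  have carrier: "\<exists>p\<in>carrier ?F. X = coset p" if "X \<in> carrier (leavitt_path_algebra K G)" for X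
    using that
    by (auto simp: leavitt_path_algebra_def FactRing_def A_RCOSETS_def RCOSETS_def a_r_coset_def)
  show ?thesis
  proof unfold_locales
    show "finite B" by (rule finite_B)
  next
    fix X Y b d
    assume "X \<in> carrier (leavitt_path_algebra K G)" "Y \<in> carrier (leavitt_path_algebra K G)"
      and bd: "b \<in> B" "d \<in> B"
    then obtain p q where p: "p \<in> carrier ?F" "X = coset p" and q: "q \<in> carrier ?F" "Y = coset q"
      using carrier by metis
    have "X \<oplus>\<^bsub>leavitt_path_algebra K G\<^esub> Y = coset (p + q)"
      using A.a_rcos_sum[OF p(1) q(1)]
      by (simp add: p q leavitt_path_algebra_def FactRing_def free_algebra_def)
    then show "coset_mat (X \<oplus>\<^bsub>leavitt_path_algebra K G\<^esub> Y) b d = coset_mat X b d + coset_mat Y b d"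
      using bd p q by (simp add: coset_mat_coset mat_add)
    have "X \<otimes>\<^bsub>leavitt_path_algebra K G\<^esub> Y = coset (p * q)"
      using rcoset_mult_leavitt[OF wf_digraph p(1) q(1)]
      by (simp add: p q leavitt_path_algebra_def FactRing_def)
    then show "coset_mat (X \<otimes>\<^bsub>leavitt_path_algebra K G\<^esub> Y) b d = (\<Sum>c\<in>B. coset_mat X b c * coset_mat Y c d)"
      using bd p q by (simp add: coset_mat_coset mat_mult)
  next
    fix b d assume "b \<in> B" "d \<in> B"
    moreover have "\<one>\<^bsub>leavitt_path_algebra K G\<^esub> = coset (\<Sum>v\<in>verts G. vx v)"
      by (simp add: leavitt_path_algebra_def FactRing_def free_algebra_def)
    ultimately show "coset_mat \<one>\<^bsub>leavitt_path_algebra K G\<^esub> b d = (if b = d then 1 else 0)"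
      by (simp add: coset_mat_coset mat_vertex_sum)
  qed
qed

end

section \<open>Dimension vectors\<close>

text \<open>On the vertices of \<open>G\<close>, such an \<open>f\<close> is the same as a monoid
  homomorphism from the graph monoid of \<open>G\<close> to the natural numbers.\<close>

definition dimension_vector :: "('v, 'e) pre_digraph \<Rightarrow> ('v \<Rightarrow> nat) \<Rightarrow> bool" where
  "dimension_vector G f \<longleftrightarrow> (\<forall>v. is_regular G v \<longrightarrow> f v = (\<Sum>e\<in>out_arcs G v. f (head G e)))"

theorem dimension_vector_imp_invariant_basis_number:
  fixes G :: "('v, 'e) pre_digraph" and K :: "'k::field itself"
  assumes "fin_digraph G" and f: "dimension_vector G f" and nonzero: "\<exists>v\<in>verts G. f v \<noteq> 0"
  shows "invariant_basis_number (leavitt_path_algebra K G)"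
proof -
  interpret fin_digraph G by fact
  \<comment> \<open>\<open>?A v\<close> indexes a basis of the direct sum of the spaces at the heads
    of the edges leaving \<open>v\<close>. The dimension equation makes it as large as the basis at
    \<open>v\<close>, and \<beta> matches the two.\<close>
  let ?A = "\<lambda>v. SIGMA e:out_arcs G v. {..<f (head G e)}"
  have "\<exists>\<beta>. bij_betw \<beta> (?A v) {..<f v}" if "is_regular G v" for v
    using that f by (intro finite_same_card_bij) (auto simp: dimension_vector_def finite_out_arcs)
  then obtain \<beta> where \<beta>: "\<And>v. is_regular G v \<Longrightarrow> bij_betw (\<beta> v) (?A v) {..<f v}" by metis
  \<comment> \<open>The first component of \<open>\<gamma> v k\<close> is the edge whose summand
    contains the \<open>k\<close>-th basis vector at \<open>v\<close>, the second its index in that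
    summand.\<close>
  define \<gamma> where "\<gamma> v = inv_into (?A v) (\<beta> v)" for v
  have reg: "is_regular G (tail G e)" if "e \<in> arcs G" for e
    using that by (auto simp: is_regular_def)
  have \<beta>_less: "\<beta> (tail G e) (e, k) < f (tail G e)" if "e \<in> arcs G" "k < f (head G e)" for e k
    using bij_betwE[OF \<beta>[OF reg[OF that(1)]]] that by auto
  have \<gamma>\<beta>: "\<gamma> (tail G e) (\<beta> (tail G e) (e, k)) = (e, k)" if "e \<in> arcs G" "k < f (head G e)" for e k
    using bij_betw_inv_into_left[OF \<beta>[OF reg[OF that(1)]]] that by (auto simp: \<gamma>_def)
  have \<gamma>_mem: "\<gamma> v k \<in> ?A v" if "is_regular G v" "k < f v" for v k
    using bij_betwE[OF bij_betw_inv_into[OF \<beta>[OF that(1)]]] that by (auto simp: \<gamma>_def)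
  have \<beta>\<gamma>_inv: "\<beta> v (\<gamma> v k) = k" if "is_regular G v" "k < f v" for v k
    using bij_betw_inv_into_right[OF \<beta>[OF that(1)]] that by (auto simp: \<gamma>_def)
  define B where "B = (SIGMA v:verts G. {..<f v})"
  \<comment> \<open>As the rightmost letter acts first, an edge maps the space at its head into the
    space at its tail. The ghost edge inverts this on the summand of its edge and kills the other
    summands.\<close>
  define act :: "('v, 'e) gen \<Rightarrow> 'v \<times> nat \<Rightarrow> ('v \<times> nat) option" where
    "act g = (\<lambda>(u, k). case g of
        Vertex v \<Rightarrow> if u = v then Some (u, k) else None
      | Edge e \<Rightarrow> if e \<in> arcs G \<and> u = head G e \<and> k < f u
          then Some (tail G e, \<beta> (tail G e) (e, k)) else None
      | Ghost e \<Rightarrow> if e \<in> arcs G \<and> u = tail G e \<and> k < f u \<and> fst (\<gamma> u k) = e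
          then Some (head G e, snd (\<gamma> u k)) else None)" for g
  have \<gamma>_less: "snd (\<gamma> (tail G e) k) < f (head G e)"
    and \<beta>\<gamma>: "\<beta> (tail G e) (e, snd (\<gamma> (tail G e) k)) = k"
    if "e \<in> arcs G" "k < f (tail G e)" "fst (\<gamma> (tail G e) k) = e" for e k
    using \<gamma>_mem[OF reg[OF that(1)] that(2)] \<beta>\<gamma>_inv[OF reg[OF that(1)] that(2)] that(3)
    by (cases "\<gamma> (tail G e) k"; simp)+
  interpret partial_action B act
  proof
    show "finite B" by (simp add: B_def)
    show "b \<in> B" if "act g d = Some b" "d \<in> B" for g d b
      using that \<beta>_less \<gamma>_less
      by (auto simp: B_def act_def split: gen.splits if_splits)
  qed
  interpret leavitt_action G B act K
  proof
    fix p :: "('v, 'e, 'k) free_alg" and b d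
    assume "p \<in> leavitt_relations G" and bd: "b \<in> B" "d \<in> B"
    then show "mat p b d = 0"
    proof cases
      case (ck1 e e')
      obtain u k where d: "d = (u, k)" "k < f u" using bd by (auto simp: B_def)
      \<comment> \<open>Distinct edges with the same tail have disjoint images, because \<gamma>
        recovers the edge from a value of \<beta>.\<close>
      have "(act (Ghost e) \<circ>\<^sub>m act (Edge e')) d = (if e = e' then act (Vertex (head G e)) d else None)"
      proof (cases "u = head G e'")
        case True
        with d \<beta>_less[OF ck1(3), of k] \<gamma>\<beta>[OF ck1(3), of k] ck1(2,3) show ?thesis
          by (cases "tail G e = tail G e'") (auto simp: act_def map_comp_def)
      qed (auto simp: d act_def map_comp_def)
      then show ?thesis
        using ck1(1) by (simp add: mat_diff mat_zero mat_letter mat_letter_mult)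
    next
      case (ck2 v)
      obtain u k where d: "d = (u, k)" "k < f u" using bd by (auto simp: B_def)
      have act: "(act (Edge e) \<circ>\<^sub>m act (Ghost e)) d = (if u = v \<and> fst (\<gamma> u k) = e then Some d else None)"
        if "e \<in> out_arcs G v" for e
        using that d \<gamma>_less[of e k] \<beta>\<gamma>[of e k] by (auto simp: act_def map_comp_def)
      \<comment> \<open>The summands at \<open>v\<close> partition its basis: when
        \<open>u = v\<close>, only the edge \<open>fst (\<gamma> u k)\<close> contributes, and it
        fixes \<open>d\<close>.\<close>
      have "(\<Sum>e\<in>out_arcs G v. of_bool ((act (Edge e) \<circ>\<^sub>m act (Ghost e)) d = Some b))
          = (\<Sum>e\<in>out_arcs G v. if fst (\<gamma> u k) = e then of_bool (u = v \<and> d = b) else (0 :: 'k))"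
        by (rule sum.cong) (auto simp: act)
      also have "\<dots> = of_bool (act (Vertex v) d = Some b)"
        using \<gamma>_mem[OF ck2(2), of k] d finite_out_arcs[of v]
        by (cases "\<gamma> v k") (auto simp: act_def)
      finally show ?thesis
        using ck2(1) by (simp add: mat_diff mat_sum mat_letter mat_letter_mult)
    qed (use bd in \<open>auto simp: mat_diff mat_zero mat_letter mat_letter_mult act_def map_comp_def B_def
          split: option.splits if_splits\<close>)
  next
    fix b d assume "b \<in> B" and d: "d \<in> B"
    have "mat (\<Sum>v\<in>verts G. vx v :: ('v, 'e, 'k) free_alg) b d
        = (\<Sum>v\<in>verts G. if fst d = v then of_bool (b = d) else 0)"
      unfolding mat_sum mat_letter by (rule sum.cong) (auto simp: act_def split: prod.splits)
    also have "\<dots> = of_bool (b = d)"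
      using d by (auto simp: B_def)
    finally show "mat (\<Sum>v\<in>verts G. vx v :: ('v, 'e, 'k) free_alg) b d = of_bool (b = d)" .
  qed
  interpret matrix_representation "leavitt_path_algebra K G" B coset_mat
    by (rule matrix_representation_leavitt)
  have "B \<noteq> {}" using nonzero by (auto simp: B_def)
  then show ?thesis by (rule invariant_basis_number)
qed

section \<open>Indicator functions of isolated vertices and source cycles\<close>

text \<open>No edge ends at \<open>v\<close>, and \<open>v\<close> itself is not regular, so both
  sides of every equation are zero.\<close>

lemma dimension_vector_isolated:
  assumes "is_isolated G v"
  shows "dimension_vector G (\<lambda>u. of_bool (u = v))"
  unfolding dimension_vector_def
proof (intro allI impI)
  fix u assume "is_regular G u"
  moreover have "head G e \<noteq> v" if "e \<in> out_arcs G u" for e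
    using that assms by (auto simp: is_isolated_def is_source_def in_arcs_def)
  ultimately show "of_bool (u = v) = (\<Sum>e\<in>out_arcs G u. of_bool (head G e = v) :: nat)"
    using assms by (auto simp: is_isolated_def is_sink_def is_regular_def)
qed

text \<open>The tails followed by \<open>w\<close>, and \<open>u\<close> followed by the heads, are
  the same sequence of vertices.\<close>

lemma cas_verts:
  "pre_digraph.cas G u p w \<Longrightarrow> insert w (tail G ` set p) = insert u (head G ` set p)"
  by (induction p arbitrary: u) (auto simp: pre_digraph.cas.simps)

lemma cas_ends:
  "\<lbrakk>pre_digraph.cas G u p w; p \<noteq> []\<rbrakk> \<Longrightarrow> u \<in> tail G ` set p \<and> w \<in> head G ` set p"
proof (induction p arbitrary: u)
  case (Cons e p)
  then show ?case by (cases "p = []") (auto simp: pre_digraph.cas.simps)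
qed simp

text \<open>In-degree one forces every edge ending on the cycle to belong to it. Hence a vertex on
  the cycle emits exactly one edge with head on the cycle, and a vertex off the cycle emits
  none.\<close>

lemma dimension_vector_source_cycle:
  assumes "source_cycle G c"
  shows "dimension_vector G (\<lambda>u. of_bool (u \<in> path_verts G c))"
    and "path_verts G c \<inter> verts G \<noteq> {}"
proof -
  let ?C = "path_verts G c"
  from assms obtain u where c: "u \<in> verts G" "set c \<subseteq> arcs G" "pre_digraph.cas G u c u" "c \<noteq> []"
    and deg: "\<And>v. v \<in> ?C \<Longrightarrow> card (in_arcs G v) = 1"
    by (auto simp: source_cycle_def pre_digraph.cycle_def pre_digraph.awalk_def in_degree_def)
  \<comment> \<open>The walk is closed and nonempty, so its end vertex is both a tail and a head and
    the insertions in \<open>cas_verts\<close> change nothing.\<close>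
  have tails: "tail G ` set c = ?C" and heads: "head G ` set c = ?C"
    using cas_verts[OF c(3)] cas_ends[OF c(3,4)] by (simp_all add: path_verts_def insert_absorb)
  have "u \<in> ?C" using cas_ends[OF c(3,4)] by (auto simp: path_verts_def)
  with c show "?C \<inter> verts G \<noteq> {}" by blast
  have uniq: "e = e'" if "e \<in> arcs G" "e' \<in> arcs G" "head G e = head G e'" "head G e \<in> ?C" for e e'
  proof -
    from deg[OF that(4)] have "\<exists>a. in_arcs G (head G e) = {a}" by (simp add: card_1_singleton_iff)
    moreover have "e \<in> in_arcs G (head G e)" "e' \<in> in_arcs G (head G e)" using that by auto
    ultimately show ?thesis by (metis singletonD)
  qed
  have into: "e \<in> set c" if "e \<in> arcs G" "head G e \<in> ?C" for e
  proof -
    have "head G e \<in> head G ` set c" using that heads by simp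
    then obtain e' where "e' \<in> set c" "head G e' = head G e" by force
    with uniq[of e e'] that c(2) show ?thesis by auto
  qed
  \<comment> \<open>In-degree one makes \<open>head\<close> injective on the cycle; as the heads and the tails form the same
    finite set, \<open>tail\<close> is then injective by counting.\<close>
  have "inj_on (head G) (set c)"
  proof (rule inj_onI)
    fix e e' assume "e \<in> set c" "e' \<in> set c" "head G e = head G e'"
    moreover from this have "head G e \<in> ?C" using heads by blast
    ultimately show "e = e'" using uniq[of e e'] c(2) by blast
  qed
  then have "card (tail G ` set c) = card (set c)"
    unfolding tails heads[symmetric] by (rule card_image)
  then have inj: "inj_on (tail G) (set c)" by (intro eq_card_imp_inj_on) auto
  show "dimension_vector G (\<lambda>u. of_bool (u \<in> ?C))"
    unfolding dimension_vector_def
  proof (intro allI impI)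
    fix v assume v: "is_regular G v"
    have eq: "{e \<in> out_arcs G v. head G e \<in> ?C} = {e \<in> set c. tail G e = v}"
    proof (intro subset_antisym subsetI CollectI)
      fix e assume "e \<in> {e \<in> out_arcs G v. head G e \<in> ?C}"
      then show "e \<in> set c \<and> tail G e = v" using into[of e] by simp
    next
      fix e assume e: "e \<in> {e \<in> set c. tail G e = v}"
      then have "head G e \<in> ?C" using heads by blast
      with e c(2) show "e \<in> out_arcs G v \<and> head G e \<in> ?C" by auto
    qed
    have "(\<Sum>e\<in>out_arcs G v. of_bool (head G e \<in> ?C)) = card {e \<in> out_arcs G v. head G e \<in> ?C}"
      using v by (simp add: is_regular_def Collect_conj_eq del: in_out_arcs_conv)
    also have "\<dots> = of_bool (v \<in> ?C)"
    proof (cases "v \<in> ?C")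
      case True
      then have "v \<in> tail G ` set c" by (simp only: tails)
      then obtain e where "e \<in> set c" "tail G e = v" by force
      then have "{e \<in> set c. tail G e = v} = {e}" using inj_onD[OF inj] by blast
      then show ?thesis using True eq by simp
    next
      case False
      then have "{e \<in> set c. tail G e = v} = {}" using tails by blast
      then show ?thesis using False eq by simp
    qed
    finally show "of_bool (v \<in> ?C) = (\<Sum>e\<in>out_arcs G v. of_bool (head G e \<in> ?C) :: nat)" by simp
  qed
qed

section \<open>Pulling dimension vectors back along source eliminations\<close>

text \<open>Only edges leaving \<open>v\<close> are deleted, so every other vertex keeps its
  outgoing edges and its equation. If \<open>v\<close> is a sink, its new value is the empty sum 0
  and there is no equation at \<open>v\<close>.\<close>

lemma dimension_vector_eliminate_source:
  assumes v: "is_source G v" and f: "dimension_vector (eliminate_source G v) f"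
  shows "dimension_vector G (f(v := \<Sum>e\<in>out_arcs G v. f (head G e)))"
proof -
  have head: "head G e \<noteq> v" if "e \<in> out_arcs G u" for e u
    using that v by (auto simp: is_source_def in_arcs_def)
  have out: "out_arcs (eliminate_source G v) u = out_arcs G u" if "u \<noteq> v" for u
    using that by (auto simp: eliminate_source_def out_arcs_def)
  have "f u = (\<Sum>e\<in>out_arcs G u. f (head G e))" if "is_regular G u" "u \<noteq> v" for u
  proof -
    have "is_regular (eliminate_source G v) u"
      using that out[OF that(2)] by (auto simp: is_regular_def eliminate_source_def)
    then show ?thesis
      using f out[OF that(2)] by (auto simp: dimension_vector_def eliminate_source_def)
  qed
  then show ?thesis
    using head by (auto simp: dimension_vector_def intro!: sum.cong)
qed

lemma nonzero_dimension_vector_initial: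
  assumes proc: "source_elimination_process G Es t" and "i \<le> t"
    and "dimension_vector (Es i) f" "\<exists>v\<in>verts (Es i). f v \<noteq> 0"
  shows "\<exists>f. dimension_vector G f \<and> (\<exists>v\<in>verts G. f v \<noteq> 0)"
  using assms(2-)
proof (induction i arbitrary: f)
  case 0
  then show ?case using proc by (auto simp: source_elimination_process_def)
next
  case (Suc i)
  \<comment> \<open>The first case is the repeated one-vertex graph at the end of a process.\<close>
  then consider "Es (Suc i) = Es i"
    | v where "is_source (Es i) v" "Es (Suc i) = eliminate_source (Es i) v"
    using proc by (auto simp: source_elimination_process_def Suc_le_eq)
  then show ?case
  proof cases
    case 1
    with Suc show ?thesis by simp
  next
    case 2
    \<comment> \<open>A vertex of the smaller graph differs from \<open>v\<close>, so its nonzero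
      value survives the update at \<open>v\<close>.\<close>
    with Suc.prems obtain u where "u \<in> verts (Es i)" "u \<noteq> v" "f u \<noteq> 0"
      by (auto simp: eliminate_source_def)
    with 2 Suc.prems show ?thesis
      by (intro Suc.IH[OF _ dimension_vector_eliminate_source[OF 2(1)], of f]) auto
  qed
qed

theorem corollary3p11:
  fixes E :: "('v, 'e) pre_digraph"
    and K :: "'k::field itself"
    and Es :: "nat \<Rightarrow> ('v, 'e) pre_digraph"
    and t :: nat
  assumes "fin_digraph E"
    and "verts E \<noteq> {}"
    and "source_elimination_process E Es t"
    and "(\<exists>i\<le>t. \<exists>v. is_isolated (Es i) v) \<or> (\<exists>c. source_cycle (Es t) c)"
  shows "invariant_basis_number (leavitt_path_algebra K E)"
proof -
  \<comment> \<open>An isolated vertex gives the vector at its own stage, a source cycle at stage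
    \<open>t\<close>.\<close>
  have "\<exists>i\<le>t. \<exists>f. dimension_vector (Es i) f \<and> (\<exists>v\<in>verts (Es i). f v \<noteq> 0)"
    using assms(4)
  proof (elim disjE exE conjE)
    fix i v assume i: "i \<le> t" and v: "is_isolated (Es i) v"
    then have "v \<in> verts (Es i)" by (simp add: is_isolated_def is_source_def)
    with i dimension_vector_isolated[OF v] show ?thesis by fastforce
  next
    fix c assume c: "source_cycle (Es t) c"
    from dimension_vector_source_cycle[OF c] show ?thesis by fastforce
  qed
  then obtain i f where "i \<le> t" "dimension_vector (Es i) f" "\<exists>v\<in>verts (Es i). f v \<noteq> 0" by blast
  from nonzero_dimension_vector_initial[OF assms(3) this]
  show ?thesis using dimension_vector_imp_invariant_basis_number[OF assms(1)] by blast
qed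

end
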